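(* Let $0<\alpha<1$ and $\bar\alpha=1-\alpha$. Let $\boldsymbol v^*=\inf_{\varrho}\boldsymbol v_\varrho$ (elementwise infimum over all power control policies $\varrho$) be the minimum cost vector, and let $\mathbb T:\mathbb R_{++}^L\to\mathbb R_{++}^L$ be the mapping $$\mathbb T(\boldsymbol v)=\min_{\rho}\left\{\bar\alpha\,\boldsymbol d_\rho+\alpha\,\mathbf P_\rho\boldsymbol v\right\},$$ where the minimum over feasible power control functions $\rho$ is taken separately for each element, i.e. $\mathbb T(\boldsymbol v)(s)=\min_\rho\{\bar\alpha d_\rho(s)+\alpha\sum_{t=1}^Lq_{st}v(t)\}$ with $q_{st}$ the entries of $\mathbf P_\rho$. Then: 1. $\boldsymbol v^*$ is the fixed point of $\mathbb T$, i.e. $\mathbb T(\boldsymbol v^* )=\boldsymbol v^*$; 2. for any $\boldsymbol v_0\in\mathbb R_{++}^L$, $\lim_{T\to\infty}\mathbb T^T(\boldsymbol v_0)=\boldsymbol v^*$, where $\mathbb T^T$ is the $T$-fold iterate of $\mathbb T$.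
   Context: $\mathbb R_{++}^L$ is the set of $L$-dimensional real vectors with positive entries. Distortion. Fix $0<\eta<1$, $\bar\eta=1-\eta$, weights $w_1,w_2>0$ with $w_1+w_2=1$ and $w_1<w_2$, and channel gains $h_1,h_2>0$. For rates $\boldsymbol r=[r_1,r_2]$ with $r_1,r_2\ge 0$, put $d_1^{\min}=(\bar\eta+\eta 2^{-2r_2})2^{-2r_1}$, $d_2^{\min}=(\bar\eta+\eta2^{-2r_1})2^{-2r_2}$, $d_{12}^{\min}=(\bar\eta+\eta2^{-2(r_1+r_2)})2^{-2(r_1+r_2)}$. The minimum weighted-sum distortion $D(\boldsymbol r)$ is the minimum of $w_1D_1+w_2D_2$ over all $(D_1,D_2)$ with $D_1\ge d_1^{\min}$, $D_2\ge d_2^{\min}$, $D_1D_2\ge d_{12}^{\min}$, $D_1\le\bar\eta+\eta2^{-2r_2}$, $D_2\le\bar\eta+\eta2^{-2r_1}$. For transmit powers $\boldsymbol p=[p_1,p_2]$, $D(\boldsymbol p)$ denotes $D(\boldsymbol r)$ with $r_k=\frac12\log_2(1+h_kp_k)$, $k=1,2$. Energy states. Energies and powers are (normalized) positive integers. Node $k$ has an energy buffer of capacity $L_k$ (a positive integer), and $L=L_1L_2$. The energy state space is $\Omega=\{1,\dots,L\}$; state $s$ encodes the pair $(i,j)$ of remaining energies of nodes 1 and 2, with $1\le i\le L_1$, $1\le j\le L_2$, via $i=\lceil s/L_2\rceil$ and $j=s \bmod L_2$ (with $j=L_2$ if $s\bmod L_2=0$). Policies. A feasible power control function is a map $\rho:\Omega\to\mathbb{Z}_{++}^2$,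 $\rho(s)=(\rho_1(s),\rho_2(s))$, with $1\le\rho_1(s)\le i$ and $1\le\rho_2(s)\le j$ for every $s\in\Omega$ (where $s$ encodes $(i,j)$); $\rho_k(s)$ is the transmit power of node $k$ in state $s$. A power control policy is a sequence $\varrho=\{\rho_1,\rho_2,\dots\}$ of feasible power control functions, $\rho_\tau$ being used in slot $\tau$; $\varrho_\tau=\{\rho_\tau,\rho_{\tau+1},\dots\}$. Dynamics. In each slot node $k$ harvests a random positive integer amount $e_{k\tau}$ of energy, with known distribution, independent across nodes and slots. If the state is $(i,j)$ and powers $(p_1,p_2)$ are used, the next remaining energies are $i'=\min(i-p_1+e_1,L_1)$ and $j'=\min(j-p_2+e_2,L_2)$. For a feasible $\rho$, $\mathbf P_\rho=(q_{st})_{s,t\in\Omega}$ is the resulting row-stochastic transition matrix, $q_{st}=\Pr\{i\to i'\}\Pr\{j\to j'\}$ with $s\leftrightarrow(i,j)$, $t\leftrightarrow(i',j')$. Distortion and cost. $d_\rho(s)=D(\boldsymbol p)$ with $\boldsymbol p=\rho(s)$, and $\boldsymbol d_\rho=[d_\rho(1),\dots,d_\rho(L)]^{\mathrm T}$. The cost vector $\boldsymbol v_\varrho=[v_\varrho(1),\dots,v_\varrho(L)]^{\mathrm T}$ of a policy satisfies $\boldsymbol v_\varrho=\bar\alpha\boldsymbol d_{\rho_1}+\alpha\mathbf P_{\rho_1}\boldsymbol v_{\varrho_2}$; explicitly, $\boldsymbol v_\varrho=\sum_{\tau=1}^\infty\bar\alpha\alpha^{\tau-1}\mathbf P_{\rho_1}\cdots\mathbf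 P_{\rho_{\tau-1}}\boldsymbol d_{\rho_\tau}$ (empty product $=$ identity). *)

theory Defs
  imports "HOL-Probability.Probability"
begin

definition d1_min :: "real \<Rightarrow> real \<Rightarrow> real \<Rightarrow> real" where
  "d1_min \<eta> r1 r2 = ((1 - \<eta>) + \<eta> * 2 powr (- 2 * r2)) * 2 powr (- 2 * r1)"

definition d2_min :: "real \<Rightarrow> real \<Rightarrow> real \<Rightarrow> real" where
  "d2_min \<eta> r1 r2 = ((1 - \<eta>) + \<eta> * 2 powr (- 2 * r1)) * 2 powr (- 2 * r2)"

definition d12_min :: "real \<Rightarrow> real \<Rightarrow> real \<Rightarrow> real" where
  "d12_min \<eta> r1 r2 =
    ((1 - \<eta>) + \<eta> * 2 powr (- 2 * (r1 + r2))) * 2 powr (- 2 * (r1 + r2))"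

definition distortion_region :: "real \<Rightarrow> real \<Rightarrow> real \<Rightarrow> (real \<times> real) set" where
  "distortion_region \<eta> r1 r2 =
    {(D1, D2). D1 \<ge> d1_min \<eta> r1 r2 \<and> D2 \<ge> d2_min \<eta> r1 r2 \<and> D1 * D2 \<ge> d12_min \<eta> r1 r2 \<and>
       D1 \<le> (1 - \<eta>) + \<eta> * 2 powr (- 2 * r2) \<and> D2 \<le> (1 - \<eta>) + \<eta> * 2 powr (- 2 * r1)}"

text \<open>The infimum below is a minimum for admissible parameters; see
  \<open>rate_distortion_attained\<close>.\<close>

definition rate_distortion :: "real \<Rightarrow> real \<Rightarrow> real \<Rightarrow> real \<Rightarrow> real \<Rightarrow> real" where
  "rate_distortion \<eta> w1 w2 r1 r2 =
    (INF (D1, D2) \<in> distortion_region \<eta> r1 r2. w1 * D1 + w2 * D2)"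

lemma distortion_region_nonempty:
  assumes "0 < \<eta>" "\<eta> < 1" "0 \<le> r1" "0 \<le> r2"
  shows "distortion_region \<eta> r1 r2 \<noteq> {}"
proof -
  define a where "a = 2 powr (- 2 * r1)"
  define b where "b = 2 powr (- 2 * r2)"
  define e where "e = 1 - \<eta>"
  have a: "0 < a" "a \<le> 1" and b: "0 < b" "b \<le> 1"
    using assms powr_mono[of "- 2 * r1" 0 2] powr_mono[of "- 2 * r2" 0 2]
    by (auto simp: a_def b_def)
  have e: "0 < e" "e + \<eta> = 1" using assms by (auto simp: e_def)
  have ab: "2 powr (- 2 * (r1 + r2)) = a * b"
    by (simp add: a_def b_def powr_add[symmetric] algebra_simps)
  have ab1: "0 < a * b" "a * b \<le> 1" "a * b \<le> a" "a * b \<le> b"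
    using a b by (auto simp: mult_le_one mult_left_le mult_left_le_one_le)
  have ab2: "(a * b) * (a * b) \<le> b"
    using ab1 mult_left_le[of "a * b" "a * b"] by linarith
  have 1: "e * e * (a * b) \<le> e * e"
    using ab1 e by (simp add: mult_left_le)
  have 2: "e * \<eta> * (a * b + (a * b) * (a * b)) \<le> e * \<eta> * (a + b)"
    using e assms add_mono[OF ab1(3) ab2] by (intro mult_left_mono) auto
  have 3: "\<eta> * \<eta> * ((a * b) * (a * b)) \<le> \<eta> * \<eta> * (a * b)"
    using ab1 assms mult_left_le[of "a * b" "a * b"] by (intro mult_left_mono) auto
  have "(e + \<eta> * (a * b)) * (a * b)
      = e * (e + \<eta>) * (a * b) + \<eta> * (e + \<eta>) * ((a * b) * (a * b))"
    using e(2) by (simp add: algebra_simps)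
  also have "\<dots> \<le> (e + \<eta> * b) * (e + \<eta> * a)"
    using 1 2 3 by (simp add: algebra_simps)
  finally have main: "(e + \<eta> * (a * b)) * (a * b) \<le> (e + \<eta> * b) * (e + \<eta> * a)" .
  have pos: "0 \<le> e + \<eta> * b" "0 \<le> e + \<eta> * a" using a b e assms by auto
  have "(e + \<eta> * b, e + \<eta> * a) \<in> distortion_region \<eta> r1 r2"
    unfolding distortion_region_def d1_min_def d2_min_def d12_min_def ab
      a_def[symmetric] b_def[symmetric] e_def[symmetric]
    using main a b pos by (auto simp: mult_left_le)
  then show ?thesis by blast
qed

lemma compact_distortion_region: "compact (distortion_region \<eta> r1 r2)"
proof -
  have "distortion_region \<eta> r1 r2 =
    ({d1_min \<eta> r1 r2 .. (1 - \<eta>) + \<eta> * 2 powr (- 2 * r2)} \<times>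
     {d2_min \<eta> r1 r2 .. (1 - \<eta>) + \<eta> * 2 powr (- 2 * r1)}) \<inter>
    {z. d12_min \<eta> r1 r2 \<le> fst z * snd z}"
    by (auto simp: distortion_region_def)
  moreover have "closed {z :: real \<times> real. d12_min \<eta> r1 r2 \<le> fst z * snd z}"
    by (intro closed_Collect_le continuous_intros)
  ultimately show ?thesis by (simp add: compact_Int_closed compact_Times)
qed

lemma rate_distortion_attained:
  assumes "0 < \<eta>" "\<eta> < 1" "0 \<le> r1" "0 \<le> r2"
  shows "\<exists>(D1, D2) \<in> distortion_region \<eta> r1 r2.
    rate_distortion \<eta> w1 w2 r1 r2 = w1 * D1 + w2 * D2 \<and>
    (\<forall>(D1', D2') \<in> distortion_region \<eta> r1 r2. w1 * D1 + w2 * D2 \<le> w1 * D1' + w2 * D2')"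
proof -
  let ?f = "\<lambda>(D1, D2). w1 * D1 + w2 * D2 :: real"
  have "continuous_on (distortion_region \<eta> r1 r2) ?f"
    by (auto simp: case_prod_beta intro!: continuous_intros)
  from continuous_attains_inf[OF compact_distortion_region distortion_region_nonempty[OF assms] this]
  obtain z where z: "z \<in> distortion_region \<eta> r1 r2"
      "\<And>y. y \<in> distortion_region \<eta> r1 r2 \<Longrightarrow> ?f z \<le> ?f y" by blast
  have "rate_distortion \<eta> w1 w2 r1 r2 = ?f z"
    unfolding rate_distortion_def
    by (rule cInf_eq_minimum) (use z in auto)
  with z show ?thesis by (intro bexI[of _ z]) auto
qed

definition power_distortion ::
    "real \<Rightarrow> real \<Rightarrow> real \<Rightarrow> real \<Rightarrow> real \<Rightarrow> nat \<times> nat \<Rightarrow> real" where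
  "power_distortion \<eta> w1 w2 h1 h2 = (\<lambda>(p1, p2).
    rate_distortion \<eta> w1 w2 (1/2 * log 2 (1 + h1 * real p1)) (1/2 * log 2 (1 + h2 * real p2)))"

definition states :: "nat \<Rightarrow> nat \<Rightarrow> nat set" where
  "states L1 L2 = {1..L1 * L2}"

definition energy1 :: "nat \<Rightarrow> nat \<Rightarrow> nat" where
  "energy1 L2 s = nat \<lceil>real s / real L2\<rceil>"

definition energy2 :: "nat \<Rightarrow> nat \<Rightarrow> nat" where
  "energy2 L2 s = (if s mod L2 = 0 then L2 else s mod L2)"

text \<open>Functions and vectors over the state space are extensional (\<open>undefined\<close> outside it), so that
  equality of such objects is equality on the state space, and there are only finitely many
  feasible power control functions.\<close>

definition feasible :: "nat \<Rightarrow> nat \<Rightarrow> (nat \<Rightarrow> nat \<times> nat) set" where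
  "feasible L1 L2 = (\<Pi>\<^sub>E s\<in>states L1 L2. {1..energy1 L2 s} \<times> {1..energy2 L2 s})"

text \<open>Policies are indexed from 0: \<open>\<rho> n\<close> is the power control function of slot \<open>n + 1\<close>.\<close>

definition policies :: "nat \<Rightarrow> nat \<Rightarrow> (nat \<Rightarrow> nat \<Rightarrow> nat \<times> nat) set" where
  "policies L1 L2 = {\<rho>. \<forall>n. \<rho> n \<in> feasible L1 L2}"

definition pos_vecs :: "nat \<Rightarrow> nat \<Rightarrow> (nat \<Rightarrow> real) set" where
  "pos_vecs L1 L2 = (\<Pi>\<^sub>E s\<in>states L1 L2. {0<..})"

text \<open>The truncated subtraction is exact here, since feasible powers satisfy \<open>p \<le> i\<close>.\<close>

definition node_trans :: "nat pmf \<Rightarrow> nat \<Rightarrow> nat \<Rightarrow> nat \<Rightarrow> nat \<Rightarrow> real" where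
  "node_trans E C i p i' = measure_pmf.prob E {e. min (i - p + e) C = i'}"

text \<open>\<open>E1\<close>, \<open>E2\<close> are the distributions of the energies harvested per slot by the two nodes.\<close>

definition trans_mat ::
    "nat \<Rightarrow> nat \<Rightarrow> nat pmf \<Rightarrow> nat pmf \<Rightarrow> (nat \<Rightarrow> nat \<times> nat) \<Rightarrow> nat \<Rightarrow> nat \<Rightarrow> real" where
  "trans_mat L1 L2 E1 E2 \<rho> s t =
    node_trans E1 L1 (energy1 L2 s) (fst (\<rho> s)) (energy1 L2 t) *
    node_trans E2 L2 (energy2 L2 s) (snd (\<rho> s)) (energy2 L2 t)"

text \<open>\<open>trans_prod \<dots> \<rho> n\<close> is the product of the transition matrices of
  \<open>\<rho> 0, \<dots>, \<rho> (n - 1)\<close>, in this order.\<close>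

primrec trans_prod ::
    "nat \<Rightarrow> nat \<Rightarrow> nat pmf \<Rightarrow> nat pmf \<Rightarrow> (nat \<Rightarrow> nat \<Rightarrow> nat \<times> nat) \<Rightarrow> nat \<Rightarrow> nat \<Rightarrow> nat \<Rightarrow> real" where
  "trans_prod L1 L2 E1 E2 \<rho> 0 = (\<lambda>s t. if s = t then 1 else 0)"
| "trans_prod L1 L2 E1 E2 \<rho> (Suc n) = (\<lambda>s t.
     \<Sum>u\<in>states L1 L2. trans_prod L1 L2 E1 E2 \<rho> n s u * trans_mat L1 L2 E1 E2 (\<rho> n) u t)"

text \<open>In the following, \<open>D\<close> maps a pair of transmit powers to the resulting distortion.\<close>

definition cost ::
    "nat \<Rightarrow> nat \<Rightarrow> nat pmf \<Rightarrow> nat pmf \<Rightarrow> (nat \<times> nat \<Rightarrow> real) \<Rightarrow> real \<Rightarrow>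
     (nat \<Rightarrow> nat \<Rightarrow> nat \<times> nat) \<Rightarrow> nat \<Rightarrow> real" where
  "cost L1 L2 E1 E2 D \<alpha> \<rho> = (\<lambda>s\<in>states L1 L2.
     \<Sum>n. (1 - \<alpha>) * \<alpha> ^ n *
       (\<Sum>t\<in>states L1 L2. trans_prod L1 L2 E1 E2 \<rho> n s t * D (\<rho> n t)))"

definition min_cost ::
    "nat \<Rightarrow> nat \<Rightarrow> nat pmf \<Rightarrow> nat pmf \<Rightarrow> (nat \<times> nat \<Rightarrow> real) \<Rightarrow> real \<Rightarrow> nat \<Rightarrow> real" where
  "min_cost L1 L2 E1 E2 D \<alpha> =
    (\<lambda>s\<in>states L1 L2. INF \<rho>\<in>policies L1 L2. cost L1 L2 E1 E2 D \<alpha> \<rho> s)"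

definition bellman ::
    "nat \<Rightarrow> nat \<Rightarrow> nat pmf \<Rightarrow> nat pmf \<Rightarrow> (nat \<times> nat \<Rightarrow> real) \<Rightarrow> real \<Rightarrow>
     (nat \<Rightarrow> real) \<Rightarrow> nat \<Rightarrow> real" where
  "bellman L1 L2 E1 E2 D \<alpha> v =
    (\<lambda>s\<in>states L1 L2. MIN \<rho>\<in>feasible L1 L2.
       (1 - \<alpha>) * D (\<rho> s) + \<alpha> * (\<Sum>t\<in>states L1 L2. trans_mat L1 L2 E1 E2 \<rho> s t * v t))"

end

theory Submission
  imports Defs
begin

text \<open>The Bellman operator is a contraction with factor \<open>\<alpha>\<close> in the maximum norm, so its iterates
  converge to any fixed point. Conditioning on the first slot gives \<open>T v* \<le> v*\<close>. Let \<open>g\<close> attain all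
  the minima in \<open>T v*\<close>, and let \<open>w\<close> be the cost of always using \<open>g\<close>. Then \<open>w - v* \<le> \<alpha> P (w - v*)\<close>
  with \<open>P\<close> the transition matrix of \<open>g\<close>; at a maximum of \<open>w - v*\<close> this forces \<open>w \<le> v*\<close>, so \<open>g\<close> is
  optimal and \<open>T v* = v*\<close>.\<close>

section \<open>Positivity of the distortion\<close>

text \<open>The minimum is attained, so it suffices that every point of the region has positive
  coordinates; these are bounded below by the positive \<open>d1_min\<close> and
  \<open>d2_min\<close>.\<close>

lemma rate_distortion_pos:
  assumes "0 < \<eta>" "\<eta> < 1" "0 < w1" "0 < w2" "0 \<le> r1" "0 \<le> r2"
  shows "0 < rate_distortion \<eta> w1 w2 r1 r2"
proof -
  obtain D1 D2 where mem: "(D1, D2) \<in> distortion_region \<eta> r1 r2"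
    and eq: "rate_distortion \<eta> w1 w2 r1 r2 = w1 * D1 + w2 * D2"
    using rate_distortion_attained[OF assms(1,2,5,6), of w1 w2] by blast
  have "0 < d1_min \<eta> r1 r2" "0 < d2_min \<eta> r1 r2"
    unfolding d1_min_def d2_min_def using assms by (auto intro!: mult_pos_pos add_pos_pos)
  with mem have "0 < D1" "0 < D2" by (auto simp: distortion_region_def)
  with assms eq show ?thesis by (simp add: add_pos_pos)
qed

lemma power_distortion_pos:
  assumes "0 < \<eta>" "\<eta> < 1" "0 < w1" "0 < w2" "0 < h1" "0 < h2"
  shows "0 < power_distortion \<eta> w1 w2 h1 h2 p"
proof -
  have "0 \<le> 1/2 * log 2 (1 + h * real k)" if "0 < h" for h :: real and k
    using that by (simp add: zero_le_log_cancel_iff add_pos_nonneg)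
  with assms show ?thesis
    unfolding power_distortion_def split_beta by (intro rate_distortion_pos) auto
qed

section \<open>The encoding of energy pairs as states\<close>

text \<open>Counting states from 0 replaces the ceiling here, and the exceptional case in
  \<open>energy2\<close>, by the quotient and remainder of \<open>s - 1\<close>.\<close>

lemma energy1_eq:
  assumes "0 < L2" "0 < s"
  shows "energy1 L2 s = Suc ((s - 1) div L2)"
proof -
  define q r where "q = (s - 1) div L2" and "r = (s - 1) mod L2"
  have s: "s = q * L2 + r + 1" and r: "r < L2"
    using assms by (auto simp: q_def r_def)
  have "\<lceil>real s / real L2\<rceil> = int q + 1"
  proof (rule ceiling_unique)
    show "real_of_int (int q + 1) - 1 < real s / real L2"
      using assms s by (simp add: field_simps)
    have "real r + 1 \<le> real L2" using r by linarith
    then show "real s / real L2 \<le> real_of_int (int q + 1)"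
      using assms s by (simp add: field_simps)
  qed
  then show ?thesis by (simp add: energy1_def q_def)
qed

lemma energy2_eq:
  assumes "0 < L2" "0 < s"
  shows "energy2 L2 s = Suc ((s - 1) mod L2)"
  using assms mod_Suc[of "s - 1" L2] by (auto simp: energy2_def)

lemma energies_of_pair:
  assumes "i \<in> {1..L1}" "j \<in> {1..L2}"
  shows "energy1 L2 ((i - 1) * L2 + j) = i" "energy2 L2 ((i - 1) * L2 + j) = j"
    "(i - 1) * L2 + j \<in> states L1 L2"
proof -
  obtain a b where ab: "i = Suc a" "j = Suc b"
    using assms by (cases i; cases j) auto
  with assms have lt: "a < L1" "b < L2" by auto
  then have "0 < L2" by simp
  with ab lt show "energy1 L2 ((i - 1) * L2 + j) = i" "energy2 L2 ((i - 1) * L2 + j) = j"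
    by (simp_all add: energy1_eq energy2_eq)
  have "a * L2 + Suc b \<le> Suc a * L2" using lt by simp
  also have "\<dots> \<le> L1 * L2" using lt by (intro mult_right_mono) auto
  finally show "(i - 1) * L2 + j \<in> states L1 L2"
    using ab by (simp add: states_def)
qed

text \<open>Turns a sum over states into a double sum over the two buffers, where the product form
  of \<open>trans_mat\<close> factors.\<close>

lemma bij_betw_energies:
  assumes "0 < L2"
  shows "bij_betw (\<lambda>s. (energy1 L2 s, energy2 L2 s)) (states L1 L2) ({1..L1} \<times> {1..L2})"
proof (rule bij_betw_byWitness[where f' = "\<lambda>(i, j). (i - 1) * L2 + j"])
  show "\<forall>s\<in>states L1 L2. (case (energy1 L2 s, energy2 L2 s) of (i, j) \<Rightarrow> (i - 1) * L2 + j) = s"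
    using assms by (simp add: states_def energy1_eq energy2_eq)
  have "(s - 1) div L2 < L1" if "s \<in> states L1 L2" for s
    using that assms by (auto simp: states_def less_mult_imp_div_less)
  then show "(\<lambda>s. (energy1 L2 s, energy2 L2 s)) ` states L1 L2 \<subseteq> {1..L1} \<times> {1..L2}"
    using assms by (auto simp: states_def energy1_eq energy2_eq Suc_le_eq)
qed (use energies_of_pair in auto)

section \<open>Transition matrices and their products\<close>

text \<open>\<open>node_trans\<close> is the mass function of the image of \<open>E\<close> under
  the buffer update. A harvest of at least 1 and the cap \<open>C\<close> keep its support in
  \<open>{1..C}\<close>.\<close>

lemma sum_node_trans:
  assumes "set_pmf E \<subseteq> {1..}" "0 < C"
  shows "(\<Sum>i'=1..C. node_trans E C i p i') = 1"
proof -
  have "node_trans E C i p i' = pmf (map_pmf (\<lambda>e. min (i - p + e) C) E) i'" for i'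
    by (simp add: node_trans_def pmf_map vimage_def)
  moreover have "set_pmf (map_pmf (\<lambda>e. min (i - p + e) C) E) \<subseteq> {1..C}"
    using assms by fastforce
  ultimately show ?thesis by (simp add: sum_pmf_eq_1)
qed

lemma sum_trans_mat:
  assumes "0 < L1" "0 < L2" "set_pmf E1 \<subseteq> {1..}" "set_pmf E2 \<subseteq> {1..}"
  shows "(\<Sum>t\<in>states L1 L2. trans_mat L1 L2 E1 E2 \<rho> s t) = 1"
proof -
  let ?f = "node_trans E1 L1 (energy1 L2 s) (fst (\<rho> s))"
  let ?g = "node_trans E2 L2 (energy2 L2 s) (snd (\<rho> s))"
  have "(\<Sum>t\<in>states L1 L2. trans_mat L1 L2 E1 E2 \<rho> s t) =
      (\<Sum>(i, j)\<in>{1..L1} \<times> {1..L2}. ?f i * ?g j)"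
    using sum.reindex_bij_betw[OF bij_betw_energies[OF assms(2)], of "\<lambda>(i, j). ?f i * ?g j" L1]
    by (simp add: trans_mat_def)
  also have "\<dots> = (\<Sum>i=1..L1. ?f i) * (\<Sum>j=1..L2. ?g j)"
    by (simp add: sum_product sum.cartesian_product)
  also have "\<dots> = 1" using assms by (simp only: sum_node_trans mult_1)
  finally show ?thesis .
qed

lemma trans_mat_nonneg: "0 \<le> trans_mat L1 L2 E1 E2 \<rho> s t"
  by (simp add: trans_mat_def node_trans_def)

lemma trans_prod_nonneg: "0 \<le> trans_prod L1 L2 E1 E2 \<rho> n s t"
  by (induction n arbitrary: t) (auto intro!: sum_nonneg mult_nonneg_nonneg trans_mat_nonneg)

lemma finite_states [simp]: "finite (states L1 L2)"
  by (simp add: states_def)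

lemma finite_feasible: "finite (feasible L1 L2)"
  by (auto simp: feasible_def intro!: finite_PiE)

text \<open>The definition appends the last matrix on the right, whereas conditioning on the first
  slot needs the first matrix split off on the left. This is associativity of the matrix
  product.\<close>

lemma trans_prod_Suc_left:
  assumes "s \<in> states L1 L2" "t \<in> states L1 L2"
  shows "trans_prod L1 L2 E1 E2 \<rho> (Suc n) s t =
    (\<Sum>u\<in>states L1 L2. trans_mat L1 L2 E1 E2 (\<rho> 0) s u *
      trans_prod L1 L2 E1 E2 (\<lambda>k. \<rho> (Suc k)) n u t)"
  using assms(2)
proof (induction n arbitrary: t)
  case 0
  \<comment> \<open>On each side the identity matrix selects one summand, which needs
    \<open>s\<close> and \<open>t\<close> to be states; both sides become the same matrix
    entry.\<close>
  then show ?case using assms(1)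
    by (simp add: if_distrib[of "\<lambda>x. x * _"] if_distrib[of "\<lambda>x. _ * x"] cong: if_cong)
next
  case (Suc n)
  let ?S = "states L1 L2" and ?P = "trans_mat L1 L2 E1 E2"
  let ?Q = "trans_prod L1 L2 E1 E2 (\<lambda>k. \<rho> (Suc k))"
  have "trans_prod L1 L2 E1 E2 \<rho> (Suc (Suc n)) s t =
      (\<Sum>u\<in>?S. trans_prod L1 L2 E1 E2 \<rho> (Suc n) s u * ?P (\<rho> (Suc n)) u t)"
    by simp
  also have "\<dots> = (\<Sum>u\<in>?S. (\<Sum>x\<in>?S. ?P (\<rho> 0) s x * ?Q n x u) * ?P (\<rho> (Suc n)) u t)"
    by (intro sum.cong refl) (simp only: Suc.IH)
  also have "\<dots> = (\<Sum>x\<in>?S. \<Sum>u\<in>?S. ?P (\<rho> 0) s x * ?Q n x u * ?P (\<rho> (Suc n)) u t)"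
    unfolding sum_distrib_right by (rule sum.swap)
  also have "\<dots> = (\<Sum>x\<in>?S. ?P (\<rho> 0) s x * ?Q (Suc n) x t)"
    by (simp add: sum_distrib_left mult.assoc)
  finally show ?case .
qed

section \<open>Discounted dynamic programming\<close>

text \<open>Positivity is all that the argument uses about the distortion, so \<open>D\<close> is
  left abstract.\<close>

locale energy_control =
  fixes L1 L2 :: nat and E1 E2 :: "nat pmf" and D :: "nat \<times> nat \<Rightarrow> real" and \<alpha> :: real
  assumes capacity_pos: "0 < L1" "0 < L2"
    and harvest: "set_pmf E1 \<subseteq> {1..}" "set_pmf E2 \<subseteq> {1..}"
    and discount: "0 < \<alpha>" "\<alpha> < 1"
    and D_pos: "0 < D p"
begin

abbreviation "S \<equiv> states L1 L2"
abbreviation "F \<equiv> feasible L1 L2"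
abbreviation "R \<equiv> policies L1 L2"
abbreviation "P \<equiv> trans_mat L1 L2 E1 E2"
abbreviation "Q \<equiv> trans_prod L1 L2 E1 E2"
abbreviation "V \<equiv> cost L1 L2 E1 E2 D \<alpha>"
abbreviation "V\<^sub>m \<equiv> min_cost L1 L2 E1 E2 D \<alpha>"
abbreviation "T \<equiv> bellman L1 L2 E1 E2 D \<alpha>"

text \<open>The expression minimized in \<open>bellman\<close>, with \<open>v\<close> as the cost to
  go after one slot under \<open>\<rho>\<close>.\<close>

definition policy_step :: "(nat \<Rightarrow> nat \<times> nat) \<Rightarrow> (nat \<Rightarrow> real) \<Rightarrow> nat \<Rightarrow> real" where
  "policy_step \<rho> v s = (1 - \<alpha>) * D (\<rho> s) + \<alpha> * (\<Sum>t\<in>S. P \<rho> s t * v t)"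

lemma sum_P: "(\<Sum>t\<in>S. P \<rho> s t) = 1"
  by (rule sum_trans_mat[OF capacity_pos harvest])

lemma sum_Q: "s \<in> S \<Longrightarrow> (\<Sum>t\<in>S. Q \<rho> n s t) = 1"
proof (induction n)
  case (Suc n)
  have "(\<Sum>t\<in>S. Q \<rho> (Suc n) s t) = (\<Sum>u\<in>S. \<Sum>t\<in>S. Q \<rho> n s u * P (\<rho> n) u t)"
    unfolding trans_prod.simps by (rule sum.swap)
  also have "\<dots> = (\<Sum>u\<in>S. Q \<rho> n s u)"
    by (simp add: sum_distrib_left[symmetric] sum_P)
  finally show ?case using Suc by simp
qed simp

text \<open>Phrased for arbitrary probability weights, so that it covers the rows of both
  \<open>P\<close> and \<open>Q\<close>.\<close>

lemma average_le:
  assumes "\<And>t. t \<in> S \<Longrightarrow> 0 \<le> p t" "(\<Sum>t\<in>S. p t) = 1" "\<And>t. t \<in> S \<Longrightarrow> v t \<le> (B::real)"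
  shows "(\<Sum>t\<in>S. p t * v t) \<le> B"
proof -
  have "(\<Sum>t\<in>S. p t * v t) \<le> (\<Sum>t\<in>S. p t * B)"
    using assms by (intro sum_mono mult_left_mono) auto
  then show ?thesis using assms(2) by (simp add: sum_distrib_right[symmetric])
qed

lemma average_ge:
  assumes "\<And>t. t \<in> S \<Longrightarrow> 0 \<le> p t" "(\<Sum>t\<in>S. p t) = 1" "\<And>t. t \<in> S \<Longrightarrow> (B::real) \<le> v t"
  shows "B \<le> (\<Sum>t\<in>S. p t * v t)"
  using average_le[of p "\<lambda>t. - v t" "- B"] assms by (simp add: sum_negf)

lemma S_nonempty: "S \<noteq> {}"
  using capacity_pos by (simp add: states_def Suc_le_eq)

lemma F_nonempty: "F \<noteq> {}"
proof -
  \<comment> \<open>Every state holds at least one unit of energy at each node.\<close>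
  have "(\<lambda>s\<in>S. (1, 1)) \<in> F"
    using capacity_pos by (auto simp: feasible_def states_def energy1_eq energy2_eq)
  then show ?thesis by blast
qed

lemma policies_nonempty: "R \<noteq> {}"
  using F_nonempty by (fastforce simp: policies_def)

section \<open>Bounds and convergence of the discounted cost\<close>

text \<open>Only finitely many distortion values occur, all positive. The upper bound yields
  convergence of the cost series, the lower one positivity of the minimum cost.\<close>

lemma D_bounds:
  obtains m M where "0 < m" "\<forall>\<rho>\<in>F. \<forall>s\<in>S. m \<le> D (\<rho> s) \<and> D (\<rho> s) \<le> M"
proof -
  define X where "X = (\<lambda>(\<rho>, s). D (\<rho> s)) ` (F \<times> S)"
  have X: "finite X" "X \<noteq> {}"
    using F_nonempty S_nonempty by (auto simp: X_def finite_feasible)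
  have "D (\<rho> s) \<in> X" if "\<rho> \<in> F" "s \<in> S" for \<rho> s
    using that by (auto simp: X_def)
  moreover have "0 < Min X"
    using X D_pos by (auto simp: X_def)
  ultimately show thesis
    using X by (intro that[of "Min X" "Max X"]) auto
qed

lemma step_cost_bounds:
  assumes "\<rho> \<in> R" "s \<in> S" "\<forall>\<rho>\<in>F. \<forall>s\<in>S. m \<le> D (\<rho> s) \<and> D (\<rho> s) \<le> M"
  shows "m \<le> (\<Sum>t\<in>S. Q \<rho> n s t * D (\<rho> n t))" "(\<Sum>t\<in>S. Q \<rho> n s t * D (\<rho> n t)) \<le> M"
  using assms
  by (auto intro!: average_le average_ge simp: trans_prod_nonneg sum_Q policies_def)

text \<open>The discount weights sum to 1, so a bound on the cost of each slot is also a bound on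
  the total.\<close>

lemma discounted_sums: "(\<lambda>n. (1 - \<alpha>) * \<alpha> ^ n * c) sums c"
  using sums_mult[OF geometric_sums[of \<alpha>], of "(1 - \<alpha>) * c"] discount
  by (simp add: mult_ac)

lemma summable_cost:
  assumes "\<rho> \<in> R" "s \<in> S"
  shows "summable (\<lambda>n. (1 - \<alpha>) * \<alpha> ^ n * (\<Sum>t\<in>S. Q \<rho> n s t * D (\<rho> n t)))"
proof -
  obtain m M where mM: "0 < m" "\<forall>\<rho>\<in>F. \<forall>s\<in>S. m \<le> D (\<rho> s) \<and> D (\<rho> s) \<le> M"
    by (rule D_bounds)
  note b = step_cost_bounds[OF assms mM(2)]
  show ?thesis
  proof (rule summable_comparison_test)
    show "summable (\<lambda>n. (1 - \<alpha>) * \<alpha> ^ n * M)" using discounted_sums by (rule sums_summable)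
    have "norm ((1 - \<alpha>) * \<alpha> ^ n * (\<Sum>t\<in>S. Q \<rho> n s t * D (\<rho> n t))) \<le> (1 - \<alpha>) * \<alpha> ^ n * M" for n
      using b[of n] mM(1) discount by (simp add: abs_mult mult_left_mono)
    then show "\<exists>N. \<forall>n\<ge>N. norm ((1 - \<alpha>) * \<alpha> ^ n * (\<Sum>t\<in>S. Q \<rho> n s t * D (\<rho> n t)))
        \<le> (1 - \<alpha>) * \<alpha> ^ n * M" by blast
  qed
qed

text \<open>A bound uniform over policies makes the infimum well behaved and keeps it strictly
  positive.\<close>

lemma cost_lower_bound:
  obtains m where "0 < m" "\<And>\<rho> s. \<rho> \<in> R \<Longrightarrow> s \<in> S \<Longrightarrow> m \<le> V \<rho> s"
proof -
  obtain m M where mM: "0 < m" "\<forall>\<rho>\<in>F. \<forall>s\<in>S. m \<le> D (\<rho> s) \<and> D (\<rho> s) \<le> M"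
    by (rule D_bounds)
  have "m \<le> V \<rho> s" if "\<rho> \<in> R" "s \<in> S" for \<rho> s
  proof -
    have "(\<Sum>n. (1 - \<alpha>) * \<alpha> ^ n * m) \<le>
        (\<Sum>n. (1 - \<alpha>) * \<alpha> ^ n * (\<Sum>t\<in>S. Q \<rho> n s t * D (\<rho> n t)))"
      using discount discounted_sums[of m] step_cost_bounds(1)[OF that mM(2)]
      by (intro suminf_le summable_cost that mult_left_mono) (auto dest: sums_summable)
    then show ?thesis using sums_unique[OF discounted_sums[of m]] that(2) by (simp add: cost_def)
  qed
  with mM(1) that show thesis by blast
qed

text \<open>Conditioning on the first slot: term 0 is the immediate cost, and splitting the first
  matrix off the later terms leaves the discounted average cost of the shifted policy.\<close>

lemma cost_eq_policy_step:
  assumes "\<rho> \<in> R" "s \<in> S"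
  shows "V \<rho> s = policy_step (\<rho> 0) (V (\<lambda>k. \<rho> (Suc k))) s"
proof -
  let ?\<rho> = "\<lambda>k. \<rho> (Suc k)"
  let ?a = "\<lambda>u n. (1 - \<alpha>) * \<alpha> ^ n * (\<Sum>t\<in>S. Q ?\<rho> n u t * D (?\<rho> n t))"
  let ?b = "\<lambda>n. (1 - \<alpha>) * \<alpha> ^ n * (\<Sum>t\<in>S. Q \<rho> n s t * D (\<rho> n t))"
  have tail: "?\<rho> \<in> R" using assms(1) by (simp add: policies_def)
  have shift: "?b (Suc n) = \<alpha> * (\<Sum>u\<in>S. P (\<rho> 0) s u * ?a u n)" for n
  proof -
    have "(\<Sum>t\<in>S. Q \<rho> (Suc n) s t * D (\<rho> (Suc n) t)) =
        (\<Sum>t\<in>S. \<Sum>u\<in>S. P (\<rho> 0) s u * Q ?\<rho> n u t * D (?\<rho> n t))"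
      by (intro sum.cong refl) (simp only: trans_prod_Suc_left[OF assms(2)] sum_distrib_right)
    also have "\<dots> = (\<Sum>u\<in>S. \<Sum>t\<in>S. P (\<rho> 0) s u * Q ?\<rho> n u t * D (?\<rho> n t))"
      by (rule sum.swap)
    finally show ?thesis
      by (simp add: sum_distrib_left mult_ac del: trans_prod.simps)
  qed
  \<comment> \<open>The series and the finite sum over successor states may be exchanged because the
    series from each successor converges.\<close>
  have "(\<lambda>n. ?b (Suc n)) sums (\<alpha> * (\<Sum>u\<in>S. P (\<rho> 0) s u * V ?\<rho> u))"
    unfolding shift
    by (intro sums_mult sums_sum) (simp add: cost_def summable_sums[OF summable_cost[OF tail]])
  then have "(\<Sum>n. ?b (Suc n)) = \<alpha> * (\<Sum>u\<in>S. P (\<rho> 0) s u * V ?\<rho> u)"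
    by (rule sums_unique[symmetric])
  moreover have "?b 0 = (1 - \<alpha>) * D (\<rho> 0 s)"
    using assms(2) by (simp add: if_distrib[of "\<lambda>x. x * _"] cong: if_cong)
  moreover have "V \<rho> s = (\<Sum>n. ?b (Suc n)) + ?b 0"
    using suminf_split_head[OF summable_cost[OF assms]] assms(2) by (simp add: cost_def)
  ultimately show ?thesis by (simp add: policy_step_def)
qed

section \<open>Monotonicity and contraction of the Bellman operator\<close>

lemma policy_step_mono:
  "(\<And>t. t \<in> S \<Longrightarrow> u t \<le> v t) \<Longrightarrow> policy_step \<rho> u s \<le> policy_step \<rho> v s"
  unfolding policy_step_def using discount
  by (auto intro!: mult_left_mono sum_mono trans_mat_nonneg)

text \<open>The rows of \<open>P\<close> sum to 1, so a bound on \<open>u - v\<close> survives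
  averaging and is then discounted. \<open>B\<close> may have either sign; the optimality proof
  applies this to a gap of unknown sign.\<close>

lemma policy_step_le_add:
  assumes "\<And>t. t \<in> S \<Longrightarrow> u t \<le> v t + B"
  shows "policy_step \<rho> u s \<le> policy_step \<rho> v s + \<alpha> * B"
proof -
  have "(\<Sum>t\<in>S. P \<rho> s t * (u t - v t)) \<le> B"
    using assms by (intro average_le) (auto simp: trans_mat_nonneg sum_P diff_le_eq add.commute)
  then have "(\<Sum>t\<in>S. P \<rho> s t * u t) - (\<Sum>t\<in>S. P \<rho> s t * v t) \<le> B"
    by (simp add: right_diff_distrib sum_subtractf)
  then have "\<alpha> * ((\<Sum>t\<in>S. P \<rho> s t * u t) - (\<Sum>t\<in>S. P \<rho> s t * v t)) \<le> \<alpha> * B"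
    using discount by (intro mult_left_mono) auto
  then show ?thesis by (simp add: policy_step_def right_diff_distrib)
qed

text \<open>Only the action in \<open>s\<close> matters at \<open>s\<close>, which allows minimizers
  for different states to be glued together.\<close>

lemma policy_step_cong: "\<rho> s = \<rho>' s \<Longrightarrow> policy_step \<rho> v s = policy_step \<rho>' v s"
  by (simp add: policy_step_def trans_mat_def)

lemma bellman_le: "\<rho> \<in> F \<Longrightarrow> s \<in> S \<Longrightarrow> T v s \<le> policy_step \<rho> v s"
  unfolding bellman_def policy_step_def by (simp add: finite_feasible)

lemma bellman_attained:
  obtains g where "g \<in> F" "\<And>s. s \<in> S \<Longrightarrow> T v s = policy_step g v s"
proof -
  have "\<exists>\<rho>\<in>F. T v s = policy_step \<rho> v s" if "s \<in> S" for s
  proof -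
    have "T v s = (MIN \<rho>\<in>F. policy_step \<rho> v s)"
      using that by (simp add: bellman_def policy_step_def)
    also have "\<dots> \<in> (\<lambda>\<rho>. policy_step \<rho> v s) ` F"
      using F_nonempty by (intro Min_in) (auto simp: finite_feasible)
    finally show ?thesis by blast
  qed
  then obtain \<rho> where \<rho>: "\<And>s. s \<in> S \<Longrightarrow> \<rho> s \<in> F \<and> T v s = policy_step (\<rho> s) v s"
    by metis
  \<comment> \<open>In state \<open>s\<close>, take the action of the minimizer chosen for
    \<open>s\<close>; the restriction gives the extensionality that \<open>feasible\<close>
    demands.\<close>
  define g where "g = (\<lambda>s\<in>S. \<rho> s s)"
  have "g \<in> F"
    unfolding feasible_def
  proof (rule PiE_I)
    fix s assume "s \<in> S"
    with \<rho> have "\<rho> s \<in> F" by blast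
    from PiE_mem[OF this[unfolded feasible_def] \<open>s \<in> S\<close>] \<open>s \<in> S\<close>
    show "g s \<in> {1..energy1 L2 s} \<times> {1..energy2 L2 s}" by (simp add: g_def)
  qed (simp add: g_def)
  moreover have "T v s = policy_step g v s" if "s \<in> S" for s
    using \<rho>[OF that] policy_step_cong[of g s "\<rho> s" v] that by (simp add: g_def)
  ultimately show thesis using that by blast
qed

lemma bellman_pos:
  assumes "v \<in> pos_vecs L1 L2"
  shows "T v \<in> pos_vecs L1 L2"
proof -
  obtain g where g: "g \<in> F" "\<And>s. s \<in> S \<Longrightarrow> T v s = policy_step g v s"
    by (rule bellman_attained) blast
  have "0 < policy_step g v s" for s
    unfolding policy_step_def using discount assms
    by (intro add_pos_nonneg mult_pos_pos D_pos mult_nonneg_nonneg sum_nonneg trans_mat_nonneg)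
      (auto simp: pos_vecs_def PiE_iff less_imp_le)
  with g show ?thesis
    by (auto simp: pos_vecs_def PiE_iff) (simp add: bellman_def)
qed

text \<open>A minimizer \<open>g\<close> for \<open>v\<close> is merely a candidate for
  \<open>u\<close>, so one application of \<open>policy_step_le_add\<close> to \<open>g\<close>
  suffices.\<close>

lemma bellman_le_add:
  assumes "\<And>t. t \<in> S \<Longrightarrow> u t \<le> v t + B" "s \<in> S"
  shows "T u s \<le> T v s + \<alpha> * B"
proof -
  obtain g where g: "g \<in> F" "\<And>s. s \<in> S \<Longrightarrow> T v s = policy_step g v s"
    by (rule bellman_attained) blast
  have "T u s \<le> policy_step g u s" using g(1) assms(2) by (rule bellman_le)
  also have "\<dots> \<le> policy_step g v s + \<alpha> * B" using assms(1) by (rule policy_step_le_add)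
  finally show ?thesis using g(2)[OF assms(2)] by simp
qed

lemma bellman_iterate_contraction:
  assumes "\<And>t. t \<in> S \<Longrightarrow> \<bar>u t - v t\<bar> \<le> B" "s \<in> S"
  shows "\<bar>(T ^^ n) u s - (T ^^ n) v s\<bar> \<le> \<alpha> ^ n * B"
  using assms(2)
proof (induction n arbitrary: s)
  case 0
  then show ?case using assms(1) by simp
next
  case (Suc n)
  have le: "(T ^^ n) u t \<le> (T ^^ n) v t + \<alpha> ^ n * B" "(T ^^ n) v t \<le> (T ^^ n) u t + \<alpha> ^ n * B"
    if "t \<in> S" for t using Suc.IH[OF that] by linarith+
  have "T ((T ^^ n) u) s \<le> T ((T ^^ n) v) s + \<alpha> * (\<alpha> ^ n * B)"
    using le(1) Suc.prems by (rule bellman_le_add)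
  moreover have "T ((T ^^ n) v) s \<le> T ((T ^^ n) u) s + \<alpha> * (\<alpha> ^ n * B)"
    using le(2) Suc.prems by (rule bellman_le_add)
  ultimately show ?case by (simp add: abs_le_iff mult.assoc)
qed

section \<open>The minimum cost vector as fixed point and limit\<close>

lemma min_cost_le: "\<rho> \<in> R \<Longrightarrow> s \<in> S \<Longrightarrow> V\<^sub>m s \<le> V \<rho> s"
proof -
  assume *: "\<rho> \<in> R" "s \<in> S"
  obtain m where "\<And>\<rho>. \<rho> \<in> R \<Longrightarrow> m \<le> V \<rho> s"
    using cost_lower_bound *(2) by metis
  then have "bdd_below ((\<lambda>\<rho>. V \<rho> s) ` R)" by (auto intro!: bdd_belowI)
  with * show ?thesis by (auto simp: min_cost_def intro!: cINF_lower)
qed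

lemma le_min_cost: "s \<in> S \<Longrightarrow> (\<And>\<rho>. \<rho> \<in> R \<Longrightarrow> c \<le> V \<rho> s) \<Longrightarrow> c \<le> V\<^sub>m s"
  using policies_nonempty by (auto simp: min_cost_def intro!: cINF_greatest)

lemma min_cost_pos: "V\<^sub>m \<in> pos_vecs L1 L2"
proof -
  obtain m where m: "0 < m" "\<And>\<rho> s. \<rho> \<in> R \<Longrightarrow> s \<in> S \<Longrightarrow> m \<le> V \<rho> s"
    by (rule cost_lower_bound) blast
  then have "0 < V\<^sub>m s" if "s \<in> S" for s
    using le_min_cost[OF that, of m] that by fastforce
  then show ?thesis by (auto simp: pos_vecs_def PiE_iff) (simp add: min_cost_def)
qed

text \<open>For any policy, its first function is a candidate in the minimum, and the cost of its
  tail is at least \<open>V\<^sub>m\<close>; the infimum over policies then gives the bound.\<close>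

lemma bellman_min_cost_le:
  assumes "s \<in> S"
  shows "T V\<^sub>m s \<le> V\<^sub>m s"
proof (rule le_min_cost[OF assms])
  fix \<rho> assume \<rho>: "\<rho> \<in> R"
  then have "\<rho> 0 \<in> F" "(\<lambda>k. \<rho> (Suc k)) \<in> R" by (auto simp: policies_def)
  then have "T V\<^sub>m s \<le> policy_step (\<rho> 0) (V (\<lambda>k. \<rho> (Suc k))) s"
    using bellman_le[OF _ assms] policy_step_mono[OF min_cost_le] by (meson order_trans)
  then show "T V\<^sub>m s \<le> V \<rho> s" using cost_eq_policy_step[OF \<rho> assms] by simp
qed

lemma bellman_min_cost: "T V\<^sub>m = V\<^sub>m"
proof -
  obtain g where g: "g \<in> F" "\<And>s. s \<in> S \<Longrightarrow> T V\<^sub>m s = policy_step g V\<^sub>m s"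
    by (rule bellman_attained) blast
  define w where "w = V (\<lambda>_. g)"
  have const: "(\<lambda>_. g) \<in> R" using g(1) by (simp add: policies_def)
  have w: "w s = policy_step g w s" if "s \<in> S" for s
    using cost_eq_policy_step[OF const that] by (simp add: w_def)
  define d where "d = Max ((\<lambda>s. w s - V\<^sub>m s) ` S)"
  have d: "w s \<le> V\<^sub>m s + d" if "s \<in> S" for s
  proof -
    have "w s - V\<^sub>m s \<le> d" using that by (auto simp: d_def)
    then show ?thesis by simp
  qed
  \<comment> \<open>The chain is \<open>w = policy_step g w\<close>, at most
    \<open>policy_step g V\<^sub>m + \<alpha> * d\<close>, which equals
    \<open>T V\<^sub>m + \<alpha> * d\<close> and is at most
    \<open>V\<^sub>m + \<alpha> * d\<close>.\<close>
  have "w s - V\<^sub>m s \<le> \<alpha> * d" if "s \<in> S" for s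
    using policy_step_le_add[where u = w and v = "V\<^sub>m" and B = d, OF d, of g s]
      bellman_min_cost_le[OF that] w[OF that] g(2)[OF that]
    by linarith
  \<comment> \<open>The largest gap is attained, so the bound just shown applies to \<open>d\<close>
    itself.\<close>
  moreover have "d \<in> (\<lambda>s. w s - V\<^sub>m s) ` S"
    unfolding d_def using S_nonempty by (intro Max_in) auto
  ultimately have "d \<le> \<alpha> * d" by blast
  then have "0 \<le> (\<alpha> - 1) * d" by (simp add: algebra_simps)
  then have "d \<le> 0" using discount by (simp add: zero_le_mult_iff)
  then have eq: "w s = V\<^sub>m s" if "s \<in> S" for s
    using d[OF that] min_cost_le[OF const that] by (simp add: w_def)
  have "T V\<^sub>m s = V\<^sub>m s" if "s \<in> S" for s
  proof -
    have "policy_step g V\<^sub>m s = policy_step g w s"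
      by (simp add: policy_step_def eq)
    with g(2)[OF that] w[OF that] eq[OF that] show ?thesis by simp
  qed
  \<comment> \<open>Outside the state space both sides are \<open>undefined\<close>.\<close>
  moreover have "T V\<^sub>m s = V\<^sub>m s" if "s \<notin> S" for s
    using that by (simp add: bellman_def min_cost_def)
  ultimately show ?thesis by blast
qed

text \<open>The limit is taken in the product topology, hence pointwise on all naturals: on
  \<open>S\<close> the contraction gives a geometric bound, elsewhere the sequence is
  constant.\<close>

lemma value_iteration_converges:
  assumes "v \<in> pos_vecs L1 L2"
  shows "(\<lambda>n. (T ^^ n) v) \<longlonglongrightarrow> V\<^sub>m"
proof -
  have fixed: "(T ^^ n) V\<^sub>m = V\<^sub>m" for n
    by (induction n) (simp_all add: bellman_min_cost)
  define B where "B = Max ((\<lambda>t. \<bar>v t - V\<^sub>m t\<bar>) ` S)"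
  have B: "\<bar>v t - V\<^sub>m t\<bar> \<le> B" if "t \<in> S" for t using that by (auto simp: B_def)
  have "(\<lambda>n. (T ^^ n) v s) \<longlonglongrightarrow> V\<^sub>m s" for s
  proof (cases "s \<in> S")
    case True
    have lim: "(\<lambda>n. \<alpha> ^ n * B) \<longlonglongrightarrow> 0"
      using tendsto_mult_left_zero[OF LIMSEQ_power_zero[of \<alpha>]] discount by simp
    have le: "\<bar>(T ^^ n) v s - V\<^sub>m s\<bar> \<le> \<alpha> ^ n * B" for n
      using bellman_iterate_contraction[of v V\<^sub>m B s n, OF B True] by (simp add: fixed)
    have "(\<lambda>n. (T ^^ n) v s - V\<^sub>m s) \<longlonglongrightarrow> 0"
      by (rule Lim_null_comparison[OF always_eventually lim]) (simp add: le)
    then show ?thesis by (simp add: LIM_zero_iff)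
  next
    case False
    \<comment> \<open>All iterates, including the start vector, are extensional and so agree with
      \<open>V\<^sub>m\<close> off \<open>S\<close>.\<close>
    have "(T ^^ n) v \<in> pos_vecs L1 L2" for n
      by (induction n) (simp_all add: assms bellman_pos)
    then have "(T ^^ n) v s = V\<^sub>m s" for n
      using False min_cost_pos unfolding pos_vecs_def by (metis PiE_arb)
    then show ?thesis by simp
  qed
  then have "limitin (product_topology (\<lambda>_. euclidean) UNIV) (\<lambda>n. (T ^^ n) v) V\<^sub>m sequentially"
    by (simp add: limitin_componentwise)
  then show ?thesis by (simp add: euclidean_product_topology)
qed

end

theorem theorem5:
  fixes \<eta> w1 w2 h1 h2 \<alpha> :: real
    and L1 L2 :: nat
    and E1 E2 :: "nat pmf"
    and D :: "nat \<times> nat \<Rightarrow> real"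
    and T :: "(nat \<Rightarrow> real) \<Rightarrow> nat \<Rightarrow> real"
    and vstar :: "nat \<Rightarrow> real"
  assumes "0 < \<eta>" "\<eta> < 1"
    and "0 < w1" "0 < w2" "w1 + w2 = 1" "w1 < w2"
    and "0 < h1" "0 < h2"
    and "0 < L1" "0 < L2"
    and "set_pmf E1 \<subseteq> {1..}" "set_pmf E2 \<subseteq> {1..}"
    and "0 < \<alpha>" "\<alpha> < 1"
    and D: "D = power_distortion \<eta> w1 w2 h1 h2"
    and T: "T = bellman L1 L2 E1 E2 D \<alpha>"
    and vstar: "vstar = min_cost L1 L2 E1 E2 D \<alpha>"
  shows "T \<in> pos_vecs L1 L2 \<rightarrow> pos_vecs L1 L2 \<and>
    vstar \<in> pos_vecs L1 L2 \<and>
    T vstar = vstar \<and>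
    (\<forall>v0\<in>pos_vecs L1 L2. (\<lambda>n. (T ^^ n) v0) \<longlonglongrightarrow> vstar)"
proof -
  \<comment> \<open>The positivity required of \<open>D\<close> holds at every pair of powers by
    \<open>power_distortion_pos\<close>.\<close>
  interpret energy_control L1 L2 E1 E2 D \<alpha>
    by unfold_locales (use assms power_distortion_pos in auto)
  show ?thesis
    unfolding T vstar using bellman_pos min_cost_pos bellman_min_cost value_iteration_converges by blast
qed

end
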